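(* Let $\mathcal{K}$ be a unital associative algebra over $\mathbb{C}$ (not necessarily commutative) and let $M$ be an $n\times n$ Manin matrix over $\mathcal{K}$ for which a two-sided inverse $M^{-1}$ exists ($M^{-1}M=MM^{-1}=1$). Then: 1. Column commutativity holds for $M^{-1}$: for all $i,j,k$, $$(M^{-1})_{ij}(M^{-1})_{kj}-(M^{-1})_{kj}(M^{-1})_{ij}=0 .$$ 2. For all $i,j,k,l$ with $i\ne k$ and $j\ne l$, $$(M^{-1})_{ij}(M^{-1})_{kl}-(M^{-1})_{kj}(M^{-1})_{il}=\varepsilon\,(-1)^{i+j+k+l}\,(\det{}^{col}(M))^{-1}\,\det{}^{col}(\hat M_{jl,ik}),$$ where $\varepsilon=+1$ if $(k-i)(l-j)>0$ and $\varepsilon=-1$ if $(k-i)(l-j)<0$, and $\hat M_{jl,ik}$ is the $(n-2)\times(n-2)$ submatrix of $M$ obtained by removing the $j$-th and $l$-th rows and the $i$-th and $k$-th columns; for $n=2$ one sets $\det^{col}(\hat M_{12,12})=1$.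
   Context: A (possibly rectangular) matrix $M=(M_{ij})$ with entries in an associative ring $\mathcal{K}$ is called a Manin matrix if (1) entries lying in the same column commute with each other, and (2) $[M_{ij},M_{kl}]=[M_{kj},M_{il}]$ for all $i,j,k,l$, where $[a,b]=ab-ba$. For any $n\times n$ matrix $X$ over $\mathcal{K}$, $\det^{col}(X)=\sum_{\sigma\in S_n}\operatorname{sgn}(\sigma)\,X_{\sigma(1)1}X_{\sigma(2)2}\cdots X_{\sigma(n)n}$. For a two-sided invertible Manin matrix $M$ the element $\det^{col}(M)$ is two-sided invertible in $\mathcal{K}$; $(\det^{col}(M))^{-1}$ denotes its inverse.
   Formalization: The two-sided invertibility of det^col(M) is assumed explicitly; it does not follow from the two-sided invertibility of the Manin matrix M over a general algebra, and without it (det^col(M))^{-1} may not exist and part 1 can fail already for n=2. *)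

theory Defs
  imports
    Complex_Main
    "HOL-Combinatorics.Permutations"
    "Jordan_Normal_Form.Matrix"
    "Jordan_Normal_Form.DL_Submatrix"
begin

locale complex_algebra = vector_space scale
  for scale :: "complex \<Rightarrow> 'a::ring_1 \<Rightarrow> 'a" +
  assumes scale_mult_left: "scale c x * y = scale c (x * y)"
    and scale_mult_right: "x * scale c y = scale c (x * y)"

definition commutator :: "'a::ring \<Rightarrow> 'a \<Rightarrow> 'a" where
  "commutator a b = a * b - b * a"

definition manin_matrix :: "'a::ring mat \<Rightarrow> bool" where
  "manin_matrix M \<longleftrightarrow>
     (\<forall>i < dim_row M. \<forall>k < dim_row M. \<forall>j < dim_col M.
        M $$ (i, j) * M $$ (k, j) = M $$ (k, j) * M $$ (i, j)) \<and>
     (\<forall>i < dim_row M. \<forall>k < dim_row M. \<forall>j < dim_col M. \<forall>l < dim_col M.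
        commutator (M $$ (i, j)) (M $$ (k, l)) = commutator (M $$ (k, j)) (M $$ (i, l)))"

(* The entries need not commute, so the product is a list product, in increasing column order.
   Meant for square matrices; the determinant of the 0 x 0 matrix is 1.
   Over an arbitrary noncommutative algebra, two-sided invertibility of a Manin matrix M alone
   does not imply that det_col M is two-sided invertible: a right inverse always exists, but
   a left inverse may not (already for 2 x 2 matrices). *)
definition det_col :: "'a::ring_1 mat \<Rightarrow> 'a" where
  "det_col X = (\<Sum>\<sigma> | \<sigma> permutes {0..<dim_col X}.
     of_int (sign \<sigma>) * prod_list (map (\<lambda>j. X $$ (\<sigma> j, j)) [0..<dim_col X]))"

end

theory Submission
  imports Defs "Jordan_Normal_Form.Determinant"
begin

text \<open>
  Let \<open>\<psi>\<^sub>a\<close> be Grassmann variables commuting with the algebra, \<open>\<phi>\<^sub>i = \<Sum>\<^sub>a \<psi>\<^sub>a M\<^sub>a\<^sub>i\<close>, and \<open>N\<close> the inverse of \<open>M\<close>.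
  The Manin relations say that the \<open>\<phi>\<^sub>i\<close> anticommute and square to zero, and \<open>\<psi>\<^sub>j = \<Sum>\<^sub>i \<phi>\<^sub>i N\<^sub>i\<^sub>j\<close>.
  Let \<open>\<phi>\<^sub>C\<close> be the product of all \<open>\<phi>\<^sub>p\<close> with \<open>p \<noteq> i, k\<close>. Since \<open>\<psi>\<^sub>j\<close> commutes with the entries of \<open>N\<close>,
  \<open>\<phi>\<^sub>C \<psi>\<^sub>l \<psi>\<^sub>j = \<Sum>\<^sub>p \<Sum>\<^sub>q \<phi>\<^sub>C \<phi>\<^sub>p \<phi>\<^sub>q N\<^sub>q\<^sub>j N\<^sub>p\<^sub>l\<close>, where only \<open>{p, q} = {i, k}\<close> survives. Up to sign, the right side
  is \<open>det M (N\<^sub>i\<^sub>j N\<^sub>k\<^sub>l - N\<^sub>k\<^sub>j N\<^sub>i\<^sub>l)\<close> and the left side is the column determinant of the submatrix, or zero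
  if \<open>j = l\<close>. Multiplying by \<open>(det M)\<^sup>-\<^sup>1\<close> on the left gives both claims.
\<close>

section \<open>Coefficients of Grassmann products and the column determinant\<close>

text \<open>
  The coefficient of the ordered product of \<open>\<psi>\<^sub>a\<close> for \<open>a \<in> R\<close> in a product of linear forms. The list
  is in reverse order: its head is the last factor, along which the coefficient is expanded.
\<close>
fun wedge :: "(nat \<Rightarrow> 'a::ring_1) list \<Rightarrow> nat set \<Rightarrow> 'a" where
  "wedge [] R = (if R = {} then 1 else 0)"
| "wedge (c # cs) R = (\<Sum>a\<in>R. (- 1) ^ card {b \<in> R. a < b} * wedge cs (R - {a}) * c a)"

declare wedge.simps(2) [simp del]

text \<open>The signs depend only on the relative order of the rows, which an increasing relabelling
  preserves. This passes between the rows left after a deletion and an initial segment.\<close>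

lemma wedge_reindex:
  assumes "finite R" "strict_mono_on R f"
    and "\<And>j a. j \<in> set js \<Longrightarrow> a \<in> R \<Longrightarrow> G j a = F j (f a)"
  shows "wedge (map G js) R = wedge (map F js) (f ` R)"
  using assms
proof (induction js arbitrary: R)
  case Nil
  then show ?case by simp
next
  case (Cons j js)
  have inj: "inj_on f R"
    using Cons.prems(2) by (rule strict_mono_on_imp_inj_on)
  have "wedge (map F (j # js)) (f ` R) =
      (\<Sum>a\<in>R. (- 1) ^ card {b \<in> f ` R. f a < b} * wedge (map F js) (f ` R - {f a}) * F j (f a))"
    by (simp add: wedge.simps(2) sum.reindex[OF inj])
  also have "\<dots> = wedge (map G (j # js)) R"
    unfolding list.map wedge.simps
  proof (rule sum.cong[OF refl])
    fix a assume a: "a \<in> R"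
    have "{b \<in> f ` R. f a < b} = f ` {b \<in> R. a < b}"
      using Cons.prems(2) a by (auto simp: strict_mono_on_less)
    moreover have "inj_on f {b \<in> R. a < b}"
      using inj by (auto intro: inj_on_subset)
    ultimately have c: "card {b \<in> f ` R. f a < b} = card {b \<in> R. a < b}"
      by (simp add: card_image)
    have i: "f ` R - {f a} = f ` (R - {a})"
      using inj a by (auto simp: inj_on_def)
    have "wedge (map G js) (R - {a}) = wedge (map F js) (f ` (R - {a}))"
      by (rule Cons.IH) (use Cons.prems in \<open>auto simp: strict_mono_on_def\<close>)
    then show "(- 1) ^ card {b \<in> f ` R. f a < b} * wedge (map F js) (f ` R - {f a}) * F j (f a) =
        (- 1) ^ card {b \<in> R. a < b} * wedge (map G js) (R - {a}) * G j a"
      using c i Cons.prems(3)[of j a] a by simp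
  qed
  finally show ?case by simp
qed

text \<open>Laplace expansion along the last column, grouping permutations by the row
  \<open>a\<close> they assign to it. Products run in increasing column order, so the entry of that
  column stands rightmost, exactly where \<open>wedge\<close> puts the head of its list.\<close>

lemma sum_permutations_eq_wedge:
  fixes F :: "nat \<Rightarrow> nat \<Rightarrow> 'a::ring_1"
  shows "(\<Sum>p | p permutes {0..<n}. of_int (sign p) * prod_list (map (\<lambda>j. F j (p j)) [0..<n])) =
    wedge (map F (rev [0..<n])) {0..<n}"
proof (induction n arbitrary: F)
  case 0
  then show ?case by (simp add: sign_id)
next
  case (Suc n)
  let ?P = "\<lambda>n. {p. p permutes {0..<n}}"
  let ?t = "\<lambda>p. of_int (sign p) * prod_list (map (\<lambda>j. F j (p j)) [0..<Suc n])"
  have rev_upt: "rev [0..<Suc n] = n # rev [0..<n]"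
    by simp
  have fin: "finite (?P (Suc n))"
    by (simp add: finite_permutations)
  have "sum ?t (?P (Suc n)) = (\<Sum>a\<in>{0..<Suc n}. sum ?t {p \<in> ?P (Suc n). p n = a})"
  proof (rule sum.group[symmetric])
    show "(\<lambda>p. p n) ` ?P (Suc n) \<subseteq> {0..<Suc n}"
      by (intro image_subsetI) (simp add: permutes_in_image del: atLeastLessThan_iff, simp)
  qed (use fin in auto)
  also have "\<dots> = wedge (map F (rev [0..<Suc n])) {0..<Suc n}"
    unfolding rev_upt list.map wedge.simps
  proof (rule sum.cong[OF refl])
    fix a assume "a \<in> {0..<Suc n}"
    then have a: "a < Suc n" by simp
    have eq: "{p \<in> ?P (Suc n). p n = a} = permutation_insert n a ` ?P n"
      using permutation_fix[OF lessI a] by simp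
    have "sum ?t {p \<in> ?P (Suc n). p n = a} = (\<Sum>q\<in>?P n. ?t (permutation_insert n a q))"
      unfolding eq by (simp add: sum.reindex[OF permutation_insert_inj_on[OF lessI a]])
    also have "\<dots> = (\<Sum>q\<in>?P n. (- 1) ^ (n + a) *
        (of_int (sign q) * prod_list (map (\<lambda>j. F j (insert_index a (q j))) [0..<n])) * F n a)"
    proof (rule sum.cong[OF refl])
      fix q assume "q \<in> ?P n"
      then have q: "q permutes {0..<n}" by simp
      have m: "map (\<lambda>j. F j (permutation_insert n a q j)) [0..<n] =
          map (\<lambda>j. F j (insert_index a (q j))) [0..<n]"
        by (auto simp: permutation_insert_expand insert_index_def)
      show "?t (permutation_insert n a q) = (- 1) ^ (n + a) *
        (of_int (sign q) * prod_list (map (\<lambda>j. F j (insert_index a (q j))) [0..<n])) * F n a"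
        by (simp add: signof_permutation_insert[OF q lessI a] m mult.assoc)
    qed
    also have "\<dots> = (- 1) ^ (n + a) *
        wedge (map (\<lambda>j b. F j (insert_index a b)) (rev [0..<n])) {0..<n} * F n a"
      by (simp add: Suc.IH[symmetric] sum_distrib_left sum_distrib_right)
    \<comment> \<open>\<open>insert_index a\<close> is increasing and skips \<open>a\<close>, so it
      restores the original numbers of the remaining rows.\<close>
    also have "wedge (map (\<lambda>j b. F j (insert_index a b)) (rev [0..<n])) {0..<n} =
        wedge (map F (rev [0..<n])) (insert_index a ` {0..<n})"
      by (rule wedge_reindex) (auto simp: strict_mono_on_def insert_index_def)
    also have "insert_index a ` {0..<n} = {0..<Suc n} - {a}"
      by (rule insert_index_image[OF a])
    also have "(- 1) ^ (n + a) = (- 1 :: 'a) ^ card {b \<in> {0..<Suc n}. a < b}"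
    proof -
      have "{b \<in> {0..<Suc n}. a < b} = {a<..n}" by auto
      then have "card {b \<in> {0..<Suc n}. a < b} = n - a" by simp
      moreover have "even (n + a) \<longleftrightarrow> even (n - a)" using a by simp
      ultimately show ?thesis by (simp only: minus_one_power_iff)
    qed
    finally show "sum ?t {p \<in> ?P (Suc n). p n = a} = (- 1) ^ card {b \<in> {0..<Suc n}. a < b} *
        wedge (map F (rev [0..<n])) ({0..<Suc n} - {a}) * F n a" .
  qed
  finally show ?case .
qed

section \<open>Anticommutation and vanishing for Manin columns\<close>

text \<open>Choosing rows \<open>(a, b)\<close> or \<open>(b, a)\<close> for the last two factors
  leaves the same tail with opposite signs. The paired terms form a bracket, to which the Manin
  relations apply.\<close>

lemma wedge_two:
  assumes "finite R"
  shows "wedge (u # v # cs) R =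
    (\<Sum>(a, b) \<in> {(a, b) \<in> R \<times> R. b < a}. (- 1) ^ card {c \<in> R. a < c} *
      (- 1) ^ card {c \<in> R - {a}. b < c} * wedge cs (R - {a, b}) * (v b * u a - v a * u b))"
proof -
  define s where "s a b = (- 1 :: 'a) ^ card {c \<in> R. a < c} * (- 1) ^ card {c \<in> R - {a}. b < c}" for a b
  \<comment> \<open>The two sign exponents differ by one: when the smaller row \<open>b\<close> is
    removed first, \<open>a\<close> is still present and is counted.\<close>
  have s_swap: "s b a = - s a b" if "a \<in> R" "b \<in> R" "b < a" for a b
  proof -
    have 1: "{c \<in> R - {b}. a < c} = {c \<in> R. a < c}" using that by auto
    have 2: "{c \<in> R. b < c} = insert a {c \<in> R - {a}. b < c}" using that by auto
    have "card {c \<in> R. b < c} = Suc (card {c \<in> R - {a}. b < c})"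
      unfolding 2 using assms by (subst card_insert_disjoint) auto
    then show ?thesis unfolding s_def 1 by (simp flip: power_add add: add.commute)
  qed
  define g where "g = (\<lambda>(a, b). s a b * wedge cs (R - {a, b}) * v b * u a)"
  have "wedge (u # v # cs) R = (\<Sum>a\<in>R. \<Sum>b\<in>R - {a}. g (a, b))"
    by (simp add: wedge.simps(2) g_def s_def sum_distrib_left sum_distrib_right mult.assoc Diff_insert2[symmetric]
      insert_commute)
  also have "\<dots> = sum g (SIGMA a:R. R - {a})"
    using assms by (subst sum.Sigma) auto
  also have "(SIGMA a:R. R - {a}) = {(a, b) \<in> R \<times> R. b < a} \<union> prod.swap ` {(a, b) \<in> R \<times> R. b < a}"
    by (auto simp: image_iff)
  also have "sum g \<dots> = sum g {(a, b) \<in> R \<times> R. b < a} + sum g (prod.swap ` {(a, b) \<in> R \<times> R. b < a})"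
    by (rule sum.union_disjoint) (use assms in \<open>auto intro: finite_subset[of _ "R \<times> R"]\<close>)
  also have "\<dots> = (\<Sum>(a, b) \<in> {(a, b) \<in> R \<times> R. b < a}. s a b * wedge cs (R - {a, b}) * (v b * u a - v a * u b))"
    by (simp add: sum.reindex sum.distrib[symmetric])
      (rule sum.cong[OF refl], auto simp: g_def s_swap algebra_simps insert_commute)
  finally show ?thesis unfolding s_def .
qed

text \<open>The hypothesis is the cross-commutator relation; rearranged, it says that each bracket
  of \<open>wedge_two\<close> changes sign when \<open>u\<close> and \<open>v\<close> are
  exchanged.\<close>

lemma wedge_swap:
  assumes "finite R"
    and "\<And>a b. a \<in> R \<Longrightarrow> b \<in> R \<Longrightarrow> u a * v b - v b * u a = u b * v a - v a * u b"
  shows "wedge (u # v # cs) R = - wedge (v # u # cs) R"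
proof -
  have "v b * u a - v a * u b = - (u b * v a - u a * v b)" if "a \<in> R" "b \<in> R" for a b
    using assms(2)[OF that] by (simp add: algebra_simps)
  then have *: "x * (v b * u a - v a * u b) = - (x * (u b * v a - u a * v b))"
    if "a \<in> R" "b \<in> R" for a b x
    using that by (metis mult_minus_right)
  show ?thesis
    unfolding wedge_two[OF assms(1)] sum_negf[symmetric]
    by (rule sum.cong[OF refl]) (auto simp: *)
qed

text \<open>Antisymmetry would only show that twice the coefficient is zero; commutativity within
  the column makes every bracket vanish.\<close>

lemma wedge_repeated:
  assumes "finite R" and "\<And>a b. a \<in> R \<Longrightarrow> b \<in> R \<Longrightarrow> u a * u b = u b * u a"
  shows "wedge (u # u # cs) R = 0"
  unfolding wedge_two[OF assms(1)] by (rule sum.neutral) (use assms(2) in auto)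

text \<open>Allows sign rules to be applied behind the head of the list.\<close>

lemma wedge_tail_mult:
  assumes "\<And>a. a \<in> R \<Longrightarrow> wedge cs (R - {a}) = (- 1) ^ m * wedge ds (R - {a})"
  shows "wedge (c # cs) R = (- 1) ^ m * wedge (c # ds) R"
  unfolding wedge.simps sum_distrib_left
  by (rule sum.cong[OF refl]) (simp add: assms mult.assoc[symmetric] power_add[symmetric] add.commute)

text \<open>\<open>c j a\<close> is the entry of column \<open>j\<close> in row \<open>a\<close>.
  The row set is explicit because expanding a \<open>wedge\<close> removes rows.\<close>

definition manin_cols :: "(nat \<Rightarrow> nat \<Rightarrow> 'a::ring_1) \<Rightarrow> nat set \<Rightarrow> nat set \<Rightarrow> bool" where
  "manin_cols c J R \<longleftrightarrow>
    (\<forall>j\<in>J. \<forall>a\<in>R. \<forall>b\<in>R. c j a * c j b = c j b * c j a) \<and>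
    (\<forall>j\<in>J. \<forall>l\<in>J. \<forall>a\<in>R. \<forall>b\<in>R. c j a * c l b - c l b * c j a = c j b * c l a - c l a * c j b)"

lemma manin_cols_subset: "manin_cols c J R \<Longrightarrow> S \<subseteq> R \<Longrightarrow> manin_cols c J S"
  unfolding manin_cols_def by blast

lemma wedge_manin_swap:
  assumes "manin_cols c J R" "finite R" "j \<in> J" "l \<in> J"
  shows "wedge (map c (j # l # js)) R = - wedge (map c (l # j # js)) R"
  using assms unfolding list.map by (intro wedge_swap) (auto simp: manin_cols_def)

lemma wedge_manin_move:
  assumes "manin_cols c J R" "finite R" "j \<in> J" "set js \<subseteq> J"
  shows "wedge (map c (js @ j # ks)) R = (- 1) ^ length js * wedge (map c (j # js @ ks)) R"
  using assms
proof (induction js arbitrary: R)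
  case Nil
  then show ?case by simp
next
  case (Cons x js)
  have "wedge (map c ((x # js) @ j # ks)) R = (- 1) ^ length js * wedge (map c (x # j # js @ ks)) R"
    unfolding append.simps list.map(2)[of c x]
    by (rule wedge_tail_mult) (rule Cons.IH, use Cons.prems in \<open>auto intro: manin_cols_subset\<close>)
  also have "wedge (map c (x # j # js @ ks)) R = - wedge (map c (j # x # js @ ks)) R"
    by (rule wedge_manin_swap[OF Cons.prems(1)]) (use Cons.prems in auto)
  finally show ?case by simp
qed

lemma wedge_manin_repeated:
  assumes "manin_cols c J R" "finite R" "set js \<subseteq> J" "j \<in> set js"
  shows "wedge (map c (j # js)) R = 0"
proof -
  obtain xs ys where js: "js = xs @ j # ys"
    using split_list[OF assms(4)] by blast
  have "wedge (map c (j # js)) R = (- 1) ^ length xs * wedge (map c (j # j # xs @ ys)) R"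
    unfolding js list.map(2)[of c j "xs @ j # ys"] list.map(2)[of c j "j # xs @ ys"]
    by (rule wedge_tail_mult, rule wedge_manin_move[of c J])
      (use assms js in \<open>auto intro: manin_cols_subset\<close>)
  also have "wedge (map c (j # j # xs @ ys)) R = 0"
    unfolding list.map
    by (rule wedge_repeated) (use assms in \<open>auto simp: manin_cols_def\<close>)
  finally show ?thesis by simp
qed

text \<open>Column \<open>k\<close> moves past the columns above \<open>k\<close>, then column
  \<open>i\<close> past all columns above \<open>i\<close> except \<open>k\<close>. The columns
  above \<open>k\<close> are crossed twice, so only the \<open>k - i - 1\<close> columns in between
  affect the sign.\<close>

lemma wedge_two_removed:
  assumes "manin_cols c {0..<n} R" "finite R" "i < k" "k < n"
  shows "wedge (map c (k # i # rev (filter (\<lambda>x. x \<noteq> i \<and> x \<noteq> k) [0..<n]))) R =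
    (- 1) ^ (i + k + 1) * wedge (map c (rev [0..<n])) R"
proof -
  define X Y Z where "X = rev [0..<i]" and "Y = rev [Suc i..<k]" and "Z = rev [Suc k..<n]"
  have upt: "[0..<n] = [0..<i] @ i # [Suc i..<k] @ k # [Suc k..<n]"
  proof -
    have "[0..<n] = [0..<i] @ [i..<n]"
      using upt_add_eq_append[of 0 i "n - i"] assms(3,4) by simp
    also have "[i..<n] = i # [Suc i..<n]"
      using assms(3,4) by (simp add: upt_conv_Cons)
    also have "[Suc i..<n] = [Suc i..<k] @ [k..<n]"
      using upt_add_eq_append[of "Suc i" k "n - k"] assms(3,4) by simp
    also have "[k..<n] = k # [Suc k..<n]"
      using assms(4) by (simp add: upt_conv_Cons)
    finally show ?thesis .
  qed
  have all: "rev [0..<n] = Z @ k # Y @ i # X"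
    unfolding upt X_def Y_def Z_def by simp
  have rest: "rev (filter (\<lambda>x. x \<noteq> i \<and> x \<noteq> k) [0..<n]) = (Z @ Y) @ X"
    unfolding upt X_def Y_def Z_def using assms(3) by (auto simp: filter_id_conv)
  have sub: "set Z \<subseteq> {0..<n}" "set Y \<subseteq> {0..<n}"
    using assms(3,4) by (auto simp: Z_def Y_def)
  have "wedge (map c (rev [0..<n])) R = (- 1) ^ length Z * wedge (map c (k # Z @ Y @ i # X)) R"
    unfolding all by (rule wedge_manin_move[OF assms(1,2)]) (use assms sub in auto)
  also have "wedge (map c (k # Z @ Y @ i # X)) R =
      (- 1) ^ length (Z @ Y) * wedge (map c (k # i # (Z @ Y) @ X)) R"
    unfolding list.map(2)[of c k] append_assoc[symmetric, of Z Y]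
    by (rule wedge_tail_mult, rule wedge_manin_move[of c "{0..<n}"])
      (use assms sub in \<open>auto intro: manin_cols_subset\<close>)
  finally have "wedge (map c (rev [0..<n])) R =
      (- 1) ^ (length Z + length (Z @ Y)) * wedge (map c (k # i # (Z @ Y) @ X)) R"
    by (simp add: power_add mult.assoc)
  moreover have "even (length Z + length (Z @ Y)) \<longleftrightarrow> even (i + k + 1)"
    using assms(3,4) by (auto simp: Z_def Y_def)
  ultimately show ?thesis
    unfolding rest by (auto simp: minus_one_power_iff)
qed

section \<open>Grassmann variables as columns, and linearity in the last factor\<close>

definition unit_col :: "nat \<Rightarrow> nat \<Rightarrow> 'a::ring_1" where
  "unit_col j a = (if a = j then 1 else 0)"

lemma wedge_unit_col:
  assumes "finite R"
  shows "wedge (unit_col j # cs) R =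
    (if j \<in> R then (- 1) ^ card {b \<in> R. j < b} * wedge cs (R - {j}) else 0)"
  using assms by (simp add: unit_col_def wedge.simps(2) if_distrib[of "\<lambda>x. _ * x"] sum.delta cong: if_cong)

text \<open>The head of the list contributes the rightmost factor of each term, so coefficients on
  its right can be pulled out without any commutation.\<close>

lemma wedge_lincomb:
  assumes "\<And>a. a \<in> R \<Longrightarrow> u a = (\<Sum>i\<in>I. c i a * t i)"
  shows "wedge (u # cs) R = (\<Sum>i\<in>I. wedge (c i # cs) R * t i)"
proof -
  have "wedge (u # cs) R =
      (\<Sum>a\<in>R. \<Sum>i\<in>I. (- 1) ^ card {b \<in> R. a < b} * wedge cs (R - {a}) * c i a * t i)"
    by (simp add: wedge.simps(2) assms sum_distrib_left mult.assoc)
  also have "\<dots> = (\<Sum>i\<in>I. wedge (c i # cs) R * t i)"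
    by (subst sum.swap) (simp add: wedge.simps(2) sum_distrib_right)
  finally show ?thesis .
qed

section \<open>Column determinants of submatrices\<close>

lemma pick_upt:
  assumes "m = card {i. i < n \<and> i \<in> I}"
  shows "map (pick I) [0..<m] = filter (\<lambda>x. x \<in> I) [0..<n]"
proof -
  \<comment> \<open>This side condition makes \<open>pick\<close> increasing on the indices used.
    The index sets needed later are complements of two points, hence infinite.\<close>
  have m: "m \<le> card I \<or> infinite I"
    unfolding assms by (auto intro: card_mono)
  then have mono: "pick I a < pick I b" if "a < b" "b < m" for a b
    using that by (auto intro: pick_mono)
  then have sm: "strict_mono_on {0..<m} (pick I)"
    by (auto simp: strict_mono_on_def)
  have "pick I ` {0..<m} \<subseteq> {i. i < n \<and> i \<in> I}"
    using m assms by (auto intro: pick_le pick_in_set)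
  moreover have "card (pick I ` {0..<m}) = card {i. i < n \<and> i \<in> I}"
    using strict_mono_on_imp_inj_on[OF sm] assms by (simp add: card_image)
  ultimately have "pick I ` {0..<m} = {i. i < n \<and> i \<in> I}"
    by (intro card_subset_eq) auto
  moreover have "sorted (map (pick I) [0..<m])"
    using mono by (auto simp: sorted_wrt_iff_nth_less intro: less_imp_le)
  ultimately show ?thesis
    using sm by (intro sorted_distinct_set_unique)
      (auto simp: distinct_map strict_mono_on_imp_inj_on sorted_wrt_filter)
qed

text \<open>\<open>pick\<close> numbers the kept rows increasingly, so \<open>wedge_reindex\<close>
  returns to the row numbers of \<open>M\<close>.\<close>

lemma det_col_submatrix:
  fixes M :: "'a::ring_1 mat"
  assumes "M \<in> carrier_mat r n"
    and "card {i. i < r \<and> i \<in> I} = card {j. j < n \<and> j \<in> J}"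
  shows "det_col (submatrix M I J) =
    wedge (map (\<lambda>j a. M $$ (a, j)) (rev (filter (\<lambda>j. j \<in> J) [0..<n]))) {i. i < r \<and> i \<in> I}"
proof -
  define m where "m = card {j. j < n \<and> j \<in> J}"
  have "m \<le> card I \<or> infinite I"
    unfolding m_def assms(2)[symmetric] by (auto intro: card_mono)
  then have sm: "strict_mono_on {0..<m} (pick I)"
    by (auto simp: strict_mono_on_def intro: pick_mono)
  have dims: "dim_row (submatrix M I J) = m" "dim_col (submatrix M I J) = m"
    using assms by (auto simp: dim_submatrix m_def)
  have img: "pick I ` {0..<m} = {i. i < r \<and> i \<in> I}"
    using arg_cong[OF pick_upt[of m r I], of set] assms(2) by (auto simp: m_def)
  have "det_col (submatrix M I J) =
      wedge (map (\<lambda>b a. submatrix M I J $$ (a, b)) (rev [0..<m])) {0..<m}"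
    unfolding det_col_def dims by (rule sum_permutations_eq_wedge)
  also have "\<dots> = wedge (map (\<lambda>b a. M $$ (a, pick J b)) (rev [0..<m])) (pick I ` {0..<m})"
    by (rule wedge_reindex[OF _ sm]) (use assms dims in \<open>auto simp: submatrix_index m_def\<close>)
  also have "map (\<lambda>b a. M $$ (a, pick J b)) (rev [0..<m]) =
      map (\<lambda>j a. M $$ (a, j)) (rev (map (pick J) [0..<m]))"
    by (simp add: rev_map)
  also have "map (pick J) [0..<m] = filter (\<lambda>j. j \<in> J) [0..<n]"
    by (rule pick_upt) (simp add: m_def)
  finally show ?thesis unfolding img .
qed

lemma card_two_removed:
  assumes "p < n" "q < n" "p \<noteq> q"
  shows "card {x. x < n \<and> x \<in> - {p, q}} = n - 2"
proof -
  have "{x. x < n \<and> x \<in> - {p, q}} = {..<n} - {p, q}" by auto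
  with assms show ?thesis by (simp add: card_Diff_subset)
qed

section \<open>Two-by-two minors of the inverse\<close>

lemma manin_right_inverse_minor:
  fixes c t :: "nat \<Rightarrow> nat \<Rightarrow> 'a::ring_1"
  assumes "manin_cols c {0..<n} {0..<n}"
    and inv: "\<And>a j. a < n \<Longrightarrow> j < n \<Longrightarrow> (\<Sum>k<n. c k a * t k j) = unit_col j a"
    and "i < k" "k < n" "j < n" "l < n"
  defines "rest \<equiv> rev (filter (\<lambda>x. x \<noteq> i \<and> x \<noteq> k) [0..<n])"
  shows "(- 1) ^ (i + k + 1) * wedge (map c (rev [0..<n])) {0..<n} * (t k j * t i l - t i j * t k l) =
    wedge (unit_col j # unit_col l # map c rest) {0..<n}"
proof -
  let ?R = "{0..<n}"
  let ?w = "\<lambda>p q. wedge (map c (q # p # rest)) ?R * t q j * t p l"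
  have set_rest: "set rest = {0..<n} - {i, k}"
    by (auto simp: rest_def)
  \<comment> \<open>The inner unit column is expanded while the outer one is still
    \<open>unit_col j\<close>, whose entries 0 and 1 let \<open>t p l\<close> move to the far right.
    It could not be moved past the entries of a general column.\<close>
  have "wedge (unit_col l # map c rest) (?R - {j}) =
      (\<Sum>p<n. wedge (c p # map c rest) (?R - {j}) * t p l)"
    by (rule wedge_lincomb) (simp add: inv[symmetric] \<open>l < n\<close>)
  then have "wedge (unit_col j # unit_col l # map c rest) ?R =
      (\<Sum>p<n. wedge (unit_col j # c p # map c rest) ?R * t p l)"
    using \<open>j < n\<close> by (simp add: wedge_unit_col sum_distrib_left mult.assoc)
  also have "\<dots> = (\<Sum>p<n. (\<Sum>q<n. wedge (c q # c p # map c rest) ?R * t q j) * t p l)"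
    by (intro sum.cong refl arg_cong2[where f = times] wedge_lincomb)
      (simp add: inv[symmetric] \<open>j < n\<close>)
  also have "\<dots> = (\<Sum>p<n. \<Sum>q<n. ?w p q)"
    by (simp add: sum_distrib_right)
  also have "\<dots> = (\<Sum>p\<in>{i, k}. \<Sum>q<n. ?w p q)"
  proof (rule sum.mono_neutral_right)
    show "\<forall>p\<in>{..<n} - {i, k}. (\<Sum>q<n. ?w p q) = 0"
    proof (intro ballI sum.neutral)
      fix p q assume p: "p \<in> {..<n} - {i, k}" and "q \<in> {..<n}"
      \<comment> \<open>\<open>p\<close> already occurs in \<open>rest\<close>, but the arbitrary
        column \<open>q\<close> stands before it. The repetition is therefore used in the tail, for
        every row set left after expanding along \<open>q\<close>.\<close>
      have "wedge (map c (p # rest)) S = 0" if "S \<subseteq> ?R" for S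
        by (rule wedge_manin_repeated[of c ?R])
          (use p that assms(1) set_rest in \<open>auto intro: manin_cols_subset finite_subset\<close>)
      then have "wedge (map c (q # p # rest)) ?R = 0"
        unfolding list.map(2)[of c q] wedge.simps(2)[of "c q"] by (auto intro: sum.neutral)
      then show "?w p q = 0" by simp
    qed
  qed (use assms in auto)
  \<comment> \<open>Now the head \<open>q\<close> repeats a later column unless it is the other
    element of \<open>{i, k}\<close>.\<close>
  also have "\<dots> = (\<Sum>p\<in>{i, k}. \<Sum>q\<in>{i, k} - {p}. ?w p q)"
  proof (rule sum.cong[OF refl], rule sum.mono_neutral_right)
    fix p assume p: "p \<in> {i, k}"
    show "\<forall>q\<in>{..<n} - ({i, k} - {p}). ?w p q = 0"
    proof
      fix q assume "q \<in> {..<n} - ({i, k} - {p})"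
      then have "wedge (map c (q # p # rest)) ?R = 0"
        by (intro wedge_manin_repeated[OF assms(1)]) (use p assms set_rest in auto)
      then show "?w p q = 0" by simp
    qed
  qed (use assms in auto)
  also have "\<dots> = ?w i k + ?w k i"
    using \<open>i < k\<close> by (simp add: insert_Diff_if)
  also have "wedge (map c (i # k # rest)) ?R = - wedge (map c (k # i # rest)) ?R"
    by (rule wedge_manin_swap[OF assms(1)]) (use assms in auto)
  also have "wedge (map c (k # i # rest)) ?R = (- 1) ^ (i + k + 1) * wedge (map c (rev [0..<n])) ?R"
    unfolding rest_def by (rule wedge_two_removed) (use assms in auto)
  finally show ?thesis
    by (simp add: algebra_simps)
qed

lemma wedge_two_unit_cols:
  assumes "j < n" "l < n" "j \<noteq> l"
  shows "wedge (unit_col j # unit_col l # cs) {0..<n} =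
    (if j < l then 1 else - 1) * (- 1) ^ (j + l) * wedge cs {x. x < n \<and> x \<in> - {j, l}}"
proof -
  have "{b \<in> {0..<n}. j < b} = {j<..<n}"
    by auto
  then have j: "card {b \<in> {0..<n}. j < b} = n - Suc j"
    by simp
  \<comment> \<open>If \<open>l < j\<close>, the removed row \<open>j\<close> lies above
    \<open>l\<close> and the count drops by one. This is the part of the sign
    \<open>\<epsilon>\<close> that comes from the order of \<open>j\<close> and
    \<open>l\<close>.\<close>
  have "{b \<in> {0..<n} - {j}. l < b} = (if j < l then {l<..<n} else {l<..<n} - {j})"
    using assms by auto
  then have l: "card {b \<in> {0..<n} - {j}. l < b} = (if j < l then n - Suc l else n - Suc l - 1)"
    using assms by (simp add: card_Diff_singleton)
  have R: "{0..<n} - {j} - {l} = {x. x < n \<and> x \<in> - {j, l}}"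
    by auto
  have sgn: "(- 1 :: 'a) ^ (n - Suc j) * (- 1) ^ (if j < l then n - Suc l else n - Suc l - 1) =
      (if j < l then 1 else - 1) * (- 1) ^ (j + l)"
    using assms by (auto simp: minus_one_power_iff)
  have "wedge (unit_col j # unit_col l # cs) {0..<n} =
      (- 1) ^ card {b \<in> {0..<n}. j < b} * (- 1) ^ card {b \<in> {0..<n} - {j}. l < b} *
      wedge cs ({0..<n} - {j} - {l})"
    using assms by (simp add: wedge_unit_col mult.assoc)
  then show ?thesis
    unfolding j l R sgn .
qed

text \<open>Handles both claims for \<open>i < k\<close>. The determinant stands to the left of the
  minor of \<open>N\<close>, so \<open>d\<close> cancels it from the left.\<close>

lemma manin_inverse_minor_less:
  fixes M :: "'a::ring_1 mat"
  assumes M: "M \<in> carrier_mat n n" "manin_matrix M"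
    and N: "N \<in> carrier_mat n n" "inverts_mat M N"
    and d: "d * det_col M = 1"
    and "i < k" "k < n" "j < n" "l < n"
  shows "N $$ (i, j) * N $$ (k, l) - N $$ (k, j) * N $$ (i, l) =
    (if j = l then 0 else (if j < l then 1 else - 1) * (- 1) ^ (i + j + k + l) *
      d * det_col (submatrix M (- {j, l}) (- {i, k})))"
proof -
  define c where "c = (\<lambda>j a. M $$ (a, j))"
  let ?rest = "map c (rev (filter (\<lambda>x. x \<noteq> i \<and> x \<noteq> k) [0..<n]))"
  let ?W = "wedge (unit_col j # unit_col l # ?rest) {0..<n}"
  have manin: "manin_cols c {0..<n} {0..<n}"
    using M by (auto simp: manin_cols_def manin_matrix_def commutator_def c_def)
  have inv: "(\<Sum>k<n. c k a * N $$ (k, j)) = unit_col j a" if "a < n" "j < n" for a j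
  proof -
    have "(M * N) $$ (a, j) = 1\<^sub>m n $$ (a, j)"
      using N M by (simp add: inverts_mat_def)
    then show ?thesis
      using that M N by (simp add: scalar_prod_def c_def unit_col_def atLeast0LessThan)
  qed
  have det: "det_col M = wedge (map c (rev [0..<n])) {0..<n}"
    using M(1) sum_permutations_eq_wedge[of "\<lambda>j a. M $$ (a, j)" n]
    by (simp add: det_col_def c_def)
  have "(- 1) ^ (i + k + 1) * det_col M *
      (N $$ (k, j) * N $$ (i, l) - N $$ (i, j) * N $$ (k, l)) = ?W"
    unfolding det
    by (rule manin_right_inverse_minor[where t = "\<lambda>k j. N $$ (k, j)", OF manin inv])
      (use assms in auto)
  \<comment> \<open>Reversing the difference absorbs the extra 1 in the exponent.\<close>
  then have "det_col M * (N $$ (i, j) * N $$ (k, l) - N $$ (k, j) * N $$ (i, l)) = (- 1) ^ (i + k) * ?W"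
    by (auto simp: minus_one_power_iff algebra_simps)
  then have "d * det_col M * (N $$ (i, j) * N $$ (k, l) - N $$ (k, j) * N $$ (i, l)) =
      d * ((- 1) ^ (i + k) * ?W)"
    by (simp add: mult.assoc)
  then have *: "N $$ (i, j) * N $$ (k, l) - N $$ (k, j) * N $$ (i, l) = (- 1) ^ (i + k) * (d * ?W)"
    by (auto simp: d minus_one_power_iff)
  show ?thesis
  proof (cases "j = l")
    case True
    \<comment> \<open>Row \<open>j\<close> is removed with the first unit column, and the second one
      is zero on all remaining rows.\<close>
    have "?W = 0"
      unfolding True by (simp add: wedge_unit_col)
    then show ?thesis
      using * True by simp
  next
    case False
    \<comment> \<open>For \<open>n = 2\<close> both sides are the empty case, with value 1.\<close>
    have sub: "det_col (submatrix M (- {j, l}) (- {i, k})) =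
        wedge ?rest {x. x < n \<and> x \<in> - {j, l}}"
      using det_col_submatrix[OF M(1), of "- {j, l}" "- {i, k}"] False assms
      by (simp add: card_two_removed c_def del: Compl_iff) (simp add: c_def)
    have "?W = (if j < l then 1 else - 1) * (- 1) ^ (j + l) *
        det_col (submatrix M (- {j, l}) (- {i, k}))"
      unfolding sub by (rule wedge_two_unit_cols[OF \<open>j < n\<close> \<open>l < n\<close> False])
    then show ?thesis
      using * False by (auto simp: minus_one_power_iff)
  qed
qed

theorem proposition7:
  fixes scale :: "complex \<Rightarrow> 'a::ring_1 \<Rightarrow> 'a"
    and M Minv :: "'a mat" and dinv :: 'a and n :: nat
  assumes "complex_algebra scale"
    and "M \<in> carrier_mat n n" and "manin_matrix M"
    and "Minv \<in> carrier_mat n n" and "inverts_mat Minv M" and "inverts_mat M Minv"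
    and "dinv * det_col M = 1" and "det_col M * dinv = 1"
  shows "(\<forall>i<n. \<forall>j<n. \<forall>k<n.
            Minv $$ (i, j) * Minv $$ (k, j) - Minv $$ (k, j) * Minv $$ (i, j) = 0) \<and>
         (\<forall>i<n. \<forall>j<n. \<forall>k<n. \<forall>l<n. i \<noteq> k \<longrightarrow> j \<noteq> l \<longrightarrow>
            Minv $$ (i, j) * Minv $$ (k, l) - Minv $$ (k, j) * Minv $$ (i, l) =
            (if (int k - int i) * (int l - int j) > 0 then 1 else - 1) * (- 1) ^ (i + j + k + l) *
            dinv * det_col (submatrix M (- {j, l}) (- {i, k})))"
proof (intro conjI allI impI)
  note minor = manin_inverse_minor_less[OF assms(2,3,4,6,7)]
  fix i j k assume "i < n" "j < n" "k < n"
  then show "Minv $$ (i, j) * Minv $$ (k, j) - Minv $$ (k, j) * Minv $$ (i, j) = 0"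
    using minor[of i k j j] minor[of k i j j] by (cases i k rule: linorder_cases) auto
next
  note minor = manin_inverse_minor_less[OF assms(2,3,4,6,7)]
  fix i j k l assume b: "i < n" "j < n" "k < n" "l < n" and "i \<noteq> k" "j \<noteq> l"
  let ?rhs = "(- 1) ^ (i + j + k + l) * dinv * det_col (submatrix M (- {j, l}) (- {i, k}))"
  let ?lhs = "Minv $$ (i, j) * Minv $$ (k, l) - Minv $$ (k, j) * Minv $$ (i, l)"
  have "?lhs = (if (int k - int i) * (int l - int j) > 0 then 1 else - 1) * ?rhs"
  proof (cases "i < k")
    case True
    then have "(int k - int i) * (int l - int j) > 0 \<longleftrightarrow> j < l"
      by (simp add: zero_less_mult_iff)
    then show ?thesis
      using minor[OF True b(3,2,4)] \<open>j \<noteq> l\<close> by (simp add: mult.assoc)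
  next
    case False
    then have "k < i" using \<open>i \<noteq> k\<close> by simp
    then have "(int k - int i) * (int l - int j) > 0 \<longleftrightarrow> \<not> j < l"
      using \<open>j \<noteq> l\<close> by (auto simp: zero_less_mult_iff)
    \<comment> \<open>Exchanging \<open>i\<close> and \<open>k\<close> negates the minor but leaves
      the deleted pair of columns unchanged.\<close>
    moreover have "- ?lhs = (if j < l then 1 else - 1) * ?rhs"
      using minor[OF \<open>k < i\<close> b(1,2,4)] \<open>j \<noteq> l\<close>
      by (simp add: mult.assoc insert_commute ac_simps)
    moreover have "x = (if P then 1 else - 1) * y"
      if "P \<longleftrightarrow> \<not> Q" "- x = (if Q then 1 else - 1) * y" for P Q and x y :: 'a
      using that minus_minus[of x] by (cases Q) auto
    ultimately show ?thesis by blast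
  qed
  then show "?lhs = (if (int k - int i) * (int l - int j) > 0 then 1 else - 1) *
      (- 1) ^ (i + j + k + l) * dinv * det_col (submatrix M (- {j, l}) (- {i, k}))"
    by (simp add: mult.assoc)
qed

end
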